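(* There exist finite and nonempty sets $S\subset\mathbb{N}\setminus\{1\}$ such that $\mathrm{MIN}(S)<\mathrm{FIB}(S)$ and $\operatorname{lcm}(S)$ has two distinct prime factors.
   Context: $\mathbb{N}=\{1,2,\dots\}$, $\mathbb{N}_0=\mathbb{N}\cup\{0\}$. For a finite nonempty set $A\subset\mathbb{N}_0$, its mask polynomial is $A(X)=\sum_{a\in A}X^a$. $\Phi_s(X)$ denotes the $s$-th cyclotomic polynomial. $\operatorname{lcm}(S)$ is the least common multiple of the elements of $S$; "two distinct prime factors" means exactly two. For a finite nonempty $S\subset\mathbb{N}\setminus\{1\}$, $\mathrm{MIN}(S)$ is the minimum of $|A|$ over all finite nonempty sets $A\subset\mathbb{N}_0$ such that $\Phi_s(X)\mid A(X)$ for all $s\in S$. For $N\in\mathbb{N}$ and a prime $p\mid N$, let $F^N_p(X)=\Phi_p(X^{N/p})=1+X^{N/p}+\dots+X^{(p-1)N/p}$. A finite nonempty set $A\subset\mathbb{N}_0$ is fibered on scale $N$ if there is a prime $p\mid N$ such that $F^N_p(X)\mid A(X)$. $\mathrm{FIB}(S)$ is the smallest size of a finite nonempty set $A\subset\mathbb{N}_0$ that is fibered on each scale $s\in S$ (the prime $p$ may depend on $s$). *)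

theory Defs
  imports "HOL-Number_Theory.Number_Theory" "HOL-Computational_Algebra.Computational_Algebra"
begin

section \<open>Cyclotomic polynomials\<close>

definition cyclotomic_complex :: "nat \<Rightarrow> complex poly" where
  "cyclotomic_complex n = (\<Prod>k\<in>totatives n. [:- cis (2 * pi * real k / real n), 1:])"

text \<open>
  The cyclotomic polynomials are taken in \<open>\<int>[X]\<close>, so that all divisibilities below are
  divisibilities of integer polynomials.  The description is proper: see
  \<open>map_poly_cyclotomic_poly\<close>.
\<close>
definition cyclotomic_poly :: "nat \<Rightarrow> int poly" where
  "cyclotomic_poly n = (THE p. map_poly of_int p = cyclotomic_complex n)"

lemma map_poly_of_int_mult:
  "map_poly of_int (p * q) = (map_poly of_int p * map_poly of_int q :: complex poly)"
  by (intro poly_eqI) (simp add: coeff_map_poly coeff_mult)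

lemma map_poly_of_int_add:
  "map_poly of_int (p + q) = (map_poly of_int p + map_poly of_int q :: complex poly)"
  by (intro poly_eqI) (simp add: coeff_map_poly)

lemma map_poly_of_int_diff:
  "map_poly of_int (p - q) = (map_poly of_int p - map_poly of_int q :: complex poly)"
  by (intro poly_eqI) (simp add: coeff_map_poly)

lemma map_poly_of_int_prod:
  "map_poly of_int (\<Prod>x\<in>A. f x) = (\<Prod>x\<in>A. map_poly of_int (f x) :: complex poly)"
  by (induction A rule: infinite_finite_induct) (simp_all add: map_poly_of_int_mult)

lemma map_poly_of_int_eq_iff:
  "map_poly of_int p = (map_poly of_int q :: complex poly) \<longleftrightarrow> p = q"
  by (simp add: poly_eq_iff coeff_map_poly)

lemma degree_map_poly_of_int: "degree (map_poly of_int p :: complex poly) = degree p"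
  by (intro degree_map_poly) auto

lemma lead_coeff_map_poly_of_int:
  "lead_coeff (map_poly of_int p :: complex poly) = of_int (lead_coeff p)"
  by (simp add: degree_map_poly_of_int coeff_map_poly)

lemma lead_coeff_cyclotomic_complex: "lead_coeff (cyclotomic_complex n) = 1"
  by (simp add: cyclotomic_complex_def lead_coeff_prod)

lemma monom_minus_1_eq_prod_roots:
  assumes "n > 0"
  shows "monom 1 n - 1 = (\<Prod>z | z ^ n = 1. [:- z, 1:] :: complex poly)"
proof -
  let ?p = "monom 1 n - 1 :: complex poly"
  have deg: "degree ?p = n"
    using assms degree_add_eq_right[of "- 1" "monom 1 n :: complex poly"] by (simp add: degree_monom_eq)
  have sqf: "rsquarefree ?p"
    unfolding rsquarefree_roots
    using assms by (auto simp: pderiv_diff pderiv_monom poly_monom power_0_left)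
  have "lead_coeff ?p = 1"
    using assms by (simp add: deg)
  moreover have "{z. poly ?p z = 0} = {z. z ^ n = 1}"
    by (simp add: poly_monom)
  ultimately show ?thesis
    using complex_poly_decompose_rsquarefree[OF sqf] by simp
qed

lemma prod_cyclotomic_complex:
  assumes "n > 0"
  shows "(\<Prod>d | d dvd n. cyclotomic_complex d) = monom 1 n - 1"
proof -
  define f where "f = (\<lambda>k. [:- cis (2 * pi * real k / real n), 1:])"
  define A where "A = (\<lambda>d. {k\<in>{0<..n}. gcd k n = d})"
  have *: "(\<Prod>k\<in>A d. f k) = cyclotomic_complex (n div d)" if d: "d dvd n" for d
  proof -
    have "(\<Prod>k\<in>A d. f k) = (\<Prod>k\<in>totatives (n div d). f (k * d))"
      unfolding A_def
      by (rule prod.reindex_bij_betw[OF bij_betw_totatives_gcd_eq, symmetric]) (use d assms in auto)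
    also have "\<dots> = cyclotomic_complex (n div d)"
      unfolding cyclotomic_complex_def f_def
      using d assms by (intro prod.cong refl) (auto elim!: dvdE simp: field_simps)
    finally show ?thesis .
  qed
  have "monom 1 n - 1 = (\<Prod>z | z ^ n = 1. [:- z, 1:] :: complex poly)"
    by (rule monom_minus_1_eq_prod_roots) fact
  also have "\<dots> = (\<Prod>k<n. f k)"
    unfolding f_def by (rule prod.reindex_bij_betw[OF bij_betw_roots_unity, symmetric]) fact
  also have "\<dots> = (\<Prod>k\<in>{0<..n}. f k)"
  proof (rule prod.reindex_bij_witness[of _ "\<lambda>k. if k = n then 0 else k" "\<lambda>k. if k = 0 then n else k"])
  qed (use assms in \<open>auto simp: f_def\<close>)
  also have "{0<..n} = (\<Union>d\<in>{d. d dvd n}. A d)"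
    by (auto simp: A_def)
  also have "(\<Prod>k\<in>\<dots>. f k) = (\<Prod>d | d dvd n. \<Prod>k\<in>A d. f k)"
    using assms by (intro prod.UNION_disjoint) (auto simp: A_def)
  also have "\<dots> = (\<Prod>d | d dvd n. cyclotomic_complex (n div d))"
    by (intro prod.cong refl *) auto
  also have "\<dots> = (\<Prod>d | d dvd n. cyclotomic_complex d)" using assms
    by (intro prod.reindex_bij_witness[of _ "(div) n" "(div) n"]) (auto elim: dvdE)
  finally show ?thesis ..
qed

lemma cyclotomic_complex_integral: "\<exists>p. map_poly of_int p = cyclotomic_complex n"
proof (induction n rule: less_induct)
  case (less n)
  show ?case
  proof (cases "n = 0")
    case True
    thus ?thesis by (intro exI[of _ 1]) (simp add: cyclotomic_complex_def)
  next
    case False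
    hence n: "n > 0" by simp
    let ?D = "{d. d dvd n \<and> d \<noteq> n}"
    have "\<forall>d\<in>?D. \<exists>p. map_poly of_int p = cyclotomic_complex d"
      using less n by (auto dest: dvd_imp_le)
    then obtain g where g: "\<And>d. d \<in> ?D \<Longrightarrow> map_poly of_int (g d) = cyclotomic_complex d"
      by metis
    define Q where "Q = (\<Prod>d\<in>?D. g d)"
    have mQ: "map_poly of_int Q = (\<Prod>d\<in>?D. cyclotomic_complex d)"
      unfolding Q_def map_poly_of_int_prod by (intro prod.cong refl g)
    have "lead_coeff (map_poly of_int Q :: complex poly) = 1"
      unfolding mQ by (simp add: lead_coeff_prod lead_coeff_cyclotomic_complex)
    hence lQ: "lead_coeff Q = 1"
      by (simp only: lead_coeff_map_poly_of_int of_int_eq_1_iff)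
    hence Q0: "Q \<noteq> 0" by auto
    obtain q r where qr: "pseudo_divmod (monom 1 n - 1) Q = (q, r)"
      by (cases "pseudo_divmod (monom 1 n - 1) Q")
    from pseudo_divmod[OF Q0 qr] lQ
    have eq: "monom 1 n - 1 = Q * q + r" and r: "r = 0 \<or> degree r < degree Q" by auto
    have fin: "finite {d. d dvd n}" using n by simp
    have "{d. d dvd n} = insert n ?D" by auto
    hence "(\<Prod>d | d dvd n. cyclotomic_complex d) = cyclotomic_complex n * map_poly of_int Q"
      using fin by (simp add: mQ)
    hence "map_poly of_int (monom 1 n - 1) = cyclotomic_complex n * map_poly of_int Q"
      by (simp add: prod_cyclotomic_complex[OF n] map_poly_of_int_diff map_poly_monom)
    hence "map_poly of_int Q * (cyclotomic_complex n - map_poly of_int q) = map_poly of_int r"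
      by (simp add: eq map_poly_of_int_add map_poly_of_int_mult algebra_simps)
    moreover from this have "cyclotomic_complex n - map_poly of_int q = 0"
    proof (rule_tac ccontr)
      assume *: "map_poly of_int Q * (cyclotomic_complex n - map_poly of_int q) = map_poly of_int r"
        and nz: "cyclotomic_complex n - map_poly of_int q \<noteq> 0"
      have Q': "map_poly of_int Q \<noteq> (0 :: complex poly)"
        using Q0 map_poly_of_int_eq_iff[of Q 0] by simp
      have "degree (map_poly of_int r :: complex poly) \<ge> degree (map_poly of_int Q :: complex poly)"
        unfolding *[symmetric] using Q' nz by (subst degree_mult_eq) auto
      moreover have "r \<noteq> 0"
        using * Q' nz by auto
      ultimately show False using r by (simp add: degree_map_poly_of_int)
    qed
    ultimately show ?thesis by (intro exI[of _ q]) simp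
  qed
qed

lemma map_poly_cyclotomic_poly: "map_poly of_int (cyclotomic_poly n) = cyclotomic_complex n"
proof -
  have "\<exists>!p. map_poly of_int p = cyclotomic_complex n"
    using cyclotomic_complex_integral[of n] map_poly_of_int_eq_iff by metis
  thus ?thesis unfolding cyclotomic_poly_def by (rule theI')
qed

lemma prod_cyclotomic_poly:
  assumes "n > 0"
  shows "(\<Prod>d | d dvd n. cyclotomic_poly d) = monom 1 n - 1"
proof -
  have "map_poly of_int (\<Prod>d | d dvd n. cyclotomic_poly d) =
          (map_poly of_int (monom 1 n - 1) :: complex poly)"
    using prod_cyclotomic_complex[OF assms]
    by (simp add: map_poly_of_int_prod map_poly_cyclotomic_poly map_poly_of_int_diff map_poly_monom)
  thus ?thesis by (simp only: map_poly_of_int_eq_iff)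
qed

lemma cyclotomic_poly_1: "cyclotomic_poly 1 = monom 1 1 - 1"
  using prod_cyclotomic_poly[of 1] by simp


section \<open>Mask polynomials and fibering\<close>

definition mask_poly :: "nat set \<Rightarrow> int poly" where
  "mask_poly A = (\<Sum>a\<in>A. monom 1 a)"

definition fiber_poly :: "nat \<Rightarrow> nat \<Rightarrow> int poly" where
  "fiber_poly N p = pcompose (cyclotomic_poly p) (monom 1 (N div p))"

definition fibered_on_scale :: "nat \<Rightarrow> nat set \<Rightarrow> bool" where
  "fibered_on_scale N A \<longleftrightarrow> (\<exists>p. prime p \<and> p dvd N \<and> fiber_poly N p dvd mask_poly A)"

text \<open>
  For a finite set \<open>S\<close> of integers \<open>\<ge> 2\<close> the two minima below are attained, see
  \<open>MIN_size_attained\<close> and \<open>FIB_size_attained\<close>.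
\<close>
definition MIN_size :: "nat set \<Rightarrow> nat" where
  "MIN_size S = (LEAST n. \<exists>A. finite A \<and> A \<noteq> {} \<and>
     (\<forall>s\<in>S. cyclotomic_poly s dvd mask_poly A) \<and> card A = n)"

definition FIB_size :: "nat set \<Rightarrow> nat" where
  "FIB_size S = (LEAST n. \<exists>A. finite A \<and> A \<noteq> {} \<and>
     (\<forall>s\<in>S. fibered_on_scale s A) \<and> card A = n)"

lemma mask_poly_lessThan: "(monom 1 1 - 1) * mask_poly {..<n} = monom 1 n - 1"
  using power_diff_1_eq[of "monom 1 1 :: int poly" n]
  by (simp add: mask_poly_def monom_power)

lemma monom_1_minus_1_nonzero: "n > 0 \<Longrightarrow> monom 1 n - 1 \<noteq> (0 :: int poly)"
proof
  assume n: "n > 0" and "monom 1 n - 1 = (0 :: int poly)"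
  hence "coeff (monom 1 n - 1 :: int poly) n = 0" by simp
  thus False using n by simp
qed

lemma mask_poly_lessThan_eq_prod:
  assumes "n > 0"
  shows "mask_poly {..<n} = (\<Prod>d | d dvd n \<and> d \<noteq> 1. cyclotomic_poly d)"
proof -
  have "{d. d dvd n} = insert 1 {d. d dvd n \<and> d \<noteq> 1}" by auto
  moreover have "finite {d. d dvd n}" using assms by simp
  ultimately have "monom 1 n - 1 = (monom 1 1 - 1) * (\<Prod>d | d dvd n \<and> d \<noteq> 1. cyclotomic_poly d)"
    using prod_cyclotomic_poly[OF assms] cyclotomic_poly_1 by simp
  with mask_poly_lessThan[of n] monom_1_minus_1_nonzero[of 1] show ?thesis
    by (metis mult_cancel_left zero_less_one)
qed

lemma cyclotomic_poly_prime:
  assumes "prime p"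
  shows "cyclotomic_poly p = (\<Sum>i<p. monom 1 i)"
proof -
  have "{d. d dvd p \<and> d \<noteq> 1} = {p}"
    using assms by (auto simp: prime_nat_iff)
  with mask_poly_lessThan_eq_prod[of p] prime_gt_0_nat[OF assms] show ?thesis
    by (simp add: mask_poly_def)
qed

lemma fiber_poly_eq_sum:
  assumes "prime p"
  shows "fiber_poly N p = (\<Sum>i<p. monom 1 (i * (N div p)))"
proof -
  have "pcompose (monom 1 i) (monom 1 m) = (monom 1 (i * m) :: int poly)" for i m
    by (simp add: pcompose_altdef map_poly_monom poly_monom monom_power mult.commute)
  thus ?thesis
    by (simp add: fiber_poly_def cyclotomic_poly_prime[OF assms] pcompose_sum)
qed

lemma fiber_poly_mult:
  assumes "prime p" "p dvd N"
  shows "(monom 1 (N div p) - 1) * fiber_poly N p = monom 1 N - 1"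
  using power_diff_1_eq[of "monom 1 (N div p) :: int poly" p] assms
  by (simp add: fiber_poly_eq_sum monom_power mult.commute)

lemma monom_minus_1_dvd:
  assumes "m dvd n"
  shows "monom 1 m - 1 dvd (monom 1 n - 1 :: int poly)"
proof -
  from assms obtain k where "n = m * k" by auto
  with power_diff_1_eq[of "monom 1 m :: int poly" k] show ?thesis
    by (simp add: monom_power)
qed

lemma cyclotomic_poly_dvd_mask_lessThan:
  assumes "s dvd n" "s \<noteq> 1" "n > 0"
  shows "cyclotomic_poly s dvd mask_poly {..<n}"
  unfolding mask_poly_lessThan_eq_prod[OF \<open>n > 0\<close>]
  using assms by (intro dvd_prodI) auto

lemma fibered_on_scale_lessThan:
  assumes "s dvd n" "s \<noteq> 1" "n > 0"
  shows "fibered_on_scale s {..<n}"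
proof -
  from \<open>s \<noteq> 1\<close> obtain p where p: "prime p" "p dvd s"
    using prime_factor_nat by blast
  have "monom 1 1 - 1 dvd (monom 1 (s div p) - 1 :: int poly)"
    by (rule monom_minus_1_dvd) simp
  hence "(monom 1 1 - 1) * fiber_poly s p dvd monom 1 s - 1"
    unfolding fiber_poly_mult[OF p, symmetric] by (rule mult_dvd_mono) simp
  also have "\<dots> dvd monom 1 n - 1"
    by (rule monom_minus_1_dvd) fact
  also have "\<dots> = (monom 1 1 - 1) * mask_poly {..<n}"
    by (rule mask_poly_lessThan[symmetric])
  finally have "fiber_poly s p dvd mask_poly {..<n}"
    using monom_1_minus_1_nonzero[of 1] by (simp only: dvd_mult_cancel_left) simp
  with p show ?thesis by (auto simp: fibered_on_scale_def)
qed

lemma MIN_size_attained: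
  assumes "finite S" "S \<subseteq> {1..} - {1}"
  shows "\<exists>A. finite A \<and> A \<noteq> {} \<and> (\<forall>s\<in>S. cyclotomic_poly s dvd mask_poly A) \<and>
           card A = MIN_size S"
  unfolding MIN_size_def
proof (rule LeastI_ex)
  have "Lcm S > 0" using assms by (auto intro!: Nat.gr0I simp: Lcm_0_iff)
  moreover from this have "\<forall>s\<in>S. cyclotomic_poly s dvd mask_poly {..<Lcm S}"
    using assms by (auto intro!: cyclotomic_poly_dvd_mask_lessThan)
  ultimately show "\<exists>n A. finite A \<and> A \<noteq> {} \<and> (\<forall>s\<in>S. cyclotomic_poly s dvd mask_poly A) \<and> card A = n"
    by (intro exI[of _ "{..<Lcm S}"] exI[of _ "card {..<Lcm S}"]) auto
qed

lemma FIB_size_attained: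
  assumes "finite S" "S \<subseteq> {1..} - {1}"
  shows "\<exists>A. finite A \<and> A \<noteq> {} \<and> (\<forall>s\<in>S. fibered_on_scale s A) \<and> card A = FIB_size S"
  unfolding FIB_size_def
proof (rule LeastI_ex)
  have "Lcm S > 0" using assms by (auto intro!: Nat.gr0I simp: Lcm_0_iff)
  moreover from this have "\<forall>s\<in>S. fibered_on_scale s {..<Lcm S}"
    using assms by (auto intro!: fibered_on_scale_lessThan)
  ultimately show "\<exists>n A. finite A \<and> A \<noteq> {} \<and> (\<forall>s\<in>S. fibered_on_scale s A) \<and> card A = n"
    by (intro exI[of _ "{..<Lcm S}"] exI[of _ "card {..<Lcm S}"]) auto
qed

end

theory Submission
  imports Defs
begin

text \<open>
  The witness is \<open>S = {4, 8, 16, 9, 27, 6}\<close>.  Fibering on the scales 4, 8, 16 (resp. 9, 27)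
  makes \<open>|A|\<close> divisible by \<open>2^3\<close> (resp. \<open>3^2\<close>), and fibering on the scale 6 in the direction
  \<open>p\<close> forces one more factor \<open>p\<close>, so that \<open>|A| \<ge> 144\<close>.

  Vanishing at \<open>\<Phi>\<^sub>6\<close> alone is cheaper, since a set may mix the two directions on the scale 6.
  For numbers \<open>N\<^sub>i\<^sub>j\<close> of elements congruent to \<open>i\<close> mod 2 and \<open>j\<close> mod 3, the remaining five
  conditions can be met as soon as the row sums are divisible by \<open>2^3\<close> and the column sums by
  \<open>3^2\<close>.  The matrix with rows \<open>(22, 13, 13)\<close> and \<open>(14, 5, 5)\<close> has this property and is a sum
  of a function of \<open>i\<close> and a function of \<open>j\<close>, which is the condition imposed by \<open>\<Phi>\<^sub>6\<close>; it
  has only 72 elements.  A set with this matrix is the union of the progressions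
  \<open>0, 2, \<dots>, 78\<close> and \<open>51, 53, \<dots>, 79\<close> and \<open>81, 84, \<dots>, 129\<close>: recall that \<open>\<Phi>\<^sub>s\<close> divides the mask
  polynomial of a progression of step \<open>d\<close> and length \<open>n\<close> if \<open>s\<close> divides \<open>d n\<close> but not \<open>d\<close>.
\<close>

section \<open>Progressions and their cyclotomic divisors\<close>

definition ap_poly :: "nat \<Rightarrow> nat \<Rightarrow> nat \<Rightarrow> int poly" where
  "ap_poly c d n = (\<Sum>i<n. monom 1 (c + d * i))"

definition ap :: "nat \<Rightarrow> nat \<Rightarrow> nat \<Rightarrow> nat set" where
  "ap c d n = (\<lambda>i. c + d * i) ` {..<n}"

lemma mask_poly_ap: "d > 0 \<Longrightarrow> mask_poly (ap c d n) = ap_poly c d n"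
  unfolding mask_poly_def ap_def ap_poly_def by (subst sum.reindex) (auto simp: inj_on_def)

lemma ap_poly_add: "ap_poly c d (m + n) = ap_poly c d m + ap_poly (c + d * m) d n"
  by (induction n) (simp_all add: ap_poly_def algebra_simps)

lemma ap_poly_1: "ap_poly c d (Suc 0) = monom 1 c"
  by (simp add: ap_poly_def)

lemma ap_poly_interleave: "ap_poly c 1 (2 * n) = ap_poly c 2 n + ap_poly (Suc c) 2 n"
  by (induction n) (simp_all add: ap_poly_def algebra_simps)

lemma card_ap: "d > 0 \<Longrightarrow> card (ap c d n) = n"
  unfolding ap_def by (subst card_image) (auto simp: inj_on_def)

lemma mask_poly_Un_disjoint:
  assumes "finite A" "finite B" "A \<inter> B = {}"
  shows "mask_poly (A \<union> B) = mask_poly A + mask_poly B"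
  unfolding mask_poly_def using assms by (rule sum.union_disjoint)

lemma cyclotomic_poly_dvd_monom_minus_1:
  assumes "s dvd n" "n > 0"
  shows "cyclotomic_poly s dvd monom 1 n - 1"
  unfolding prod_cyclotomic_poly[OF assms(2), symmetric] using assms by (intro dvd_prodI) auto

lemma cyclotomic_poly_dvd_monom_diff:
  assumes "s dvd b - a" "a < b"
  shows "cyclotomic_poly s dvd monom 1 b - monom 1 a"
proof -
  have "monom 1 b - monom 1 a = (monom 1 a * (monom 1 (b - a) - 1) :: int poly)"
    using assms by (simp add: algebra_simps mult_monom)
  thus ?thesis
    using cyclotomic_poly_dvd_monom_minus_1[OF assms(1)] assms(2) by simp
qed

text \<open>Up to \<open>monom 1 c\<close>, the sum is the quotient of X^(d n) - 1 by X^d - 1, and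
  \<open>cyclotomic_poly s\<close> is one of the factors that the division leaves.\<close>

lemma cyclotomic_poly_dvd_ap_poly:
  assumes "s dvd d * n" "\<not> s dvd d" "n > 0"
  shows "cyclotomic_poly s dvd ap_poly c d n"
proof -
  have d: "d > 0"
    using assms(2) by (cases d) auto
  have "s \<notin> {e. e dvd d}"
    using assms(2) by simp
  hence "cyclotomic_poly s * (monom 1 d - 1) = (\<Prod>e\<in>insert s {e. e dvd d}. cyclotomic_poly e)"
    using d by (simp add: prod_cyclotomic_poly)
  also have "\<dots> dvd (\<Prod>e | e dvd d * n. cyclotomic_poly e)"
    using d assms by (intro prod_dvd_prod_subset) auto
  also have "\<dots> = (\<Sum>i<n. monom 1 (d * i)) * (monom 1 d - 1)"
    using d assms(3) power_diff_1_eq[of "monom 1 d :: int poly" n]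
    by (simp add: prod_cyclotomic_poly monom_power mult.commute)
  finally have "cyclotomic_poly s dvd (\<Sum>i<n. monom 1 (d * i))"
    using monom_1_minus_1_nonzero[OF d] by (simp only: dvd_mult_cancel_right) simp
  moreover have "ap_poly c d n = monom 1 c * (\<Sum>i<n. monom 1 (d * i))"
    by (simp add: ap_poly_def sum_distrib_left mult_monom)
  ultimately show ?thesis
    by simp
qed

section \<open>Upper bound: a set with 72 elements\<close>

lemma MIN_size_le: "MIN_size {4, 8, 16, 9, 27, 6} \<le> 72"
proof -
  define A where "A = ap 0 2 40 \<union> ap 51 2 15 \<union> ap 81 3 17"
  have fin: "finite (ap c d n)" for c d n
    by (simp add: ap_def)
  have "ap 0 2 40 \<inter> ap 51 2 15 = {}"
    by (auto simp: ap_def) presburger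
  moreover have "(ap 0 2 40 \<union> ap 51 2 15) \<inter> ap 81 3 17 = {}"
    by (auto simp: ap_def)
  ultimately have mask: "mask_poly A = ap_poly 0 2 40 + ap_poly 51 2 15 + ap_poly 81 3 17"
    and card: "card A = 72"
    unfolding A_def by (simp_all add: mask_poly_Un_disjoint card_Un_disjoint fin mask_poly_ap card_ap)
  have "cyclotomic_poly s dvd mask_poly A" if "s \<in> {4, 8, 16}" for s
  proof -
    \<comment> \<open>Exchanging 129 for 49, which is harmless as 16 divides 80, gives the last two
      progressions length 16.\<close>
    have "mask_poly A = ap_poly 0 2 40 + ap_poly 49 2 16 + ap_poly 81 3 16 + (monom 1 129 - monom 1 49)"
      using ap_poly_add[of 49 2 1 15] ap_poly_add[of 81 3 16 1]
      by (simp add: mask ap_poly_1)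
    moreover have "cyclotomic_poly s dvd \<dots>"
      using that by (intro dvd_add cyclotomic_poly_dvd_ap_poly cyclotomic_poly_dvd_monom_diff) auto
    ultimately show ?thesis
      by simp
  qed
  moreover have "cyclotomic_poly s dvd mask_poly A" if "s \<in> {9, 27}" for s
  proof -
    \<comment> \<open>Exchanging 51 for 132, congruent modulo 27, extends the last progression to 18
      terms; the evens from 54 and the odds from 53 fill an interval of length 27.\<close>
    have "mask_poly A = ap_poly 0 2 27 + ap_poly 53 1 27 + ap_poly 81 3 18 - (monom 1 132 - monom 1 51)"
      using ap_poly_add[of 0 2 27 13] ap_poly_add[of 51 2 1 14] ap_poly_add[of 53 2 1 13]
        ap_poly_add[of 53 1 1 26] ap_poly_interleave[of 54 13] ap_poly_add[of 81 3 17 1]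
      by (simp add: mask ap_poly_1)
    moreover have "cyclotomic_poly s dvd \<dots>"
      using that by (intro dvd_add dvd_diff cyclotomic_poly_dvd_ap_poly cyclotomic_poly_dvd_monom_diff) auto
    ultimately show ?thesis
      by simp
  qed
  moreover have "cyclotomic_poly 6 dvd mask_poly A"
  proof -
    \<comment> \<open>The leftovers 48 and 81 differ by 33, an odd multiple of 3, so they form a
      progression of length 2 that suits 6.\<close>
    have "mask_poly A = ap_poly 0 2 24 + ap_poly 50 1 30 + ap_poly 48 33 2 + ap_poly 84 3 16"
      using ap_poly_add[of 0 2 24 16] ap_poly_add[of 48 2 1 15] ap_poly_interleave[of 50 15]
        ap_poly_add[of 48 33 1 1, unfolded one_add_one] ap_poly_add[of 81 3 1 16]
      by (simp add: mask ap_poly_1)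
    moreover have "cyclotomic_poly 6 dvd \<dots>"
      by (intro dvd_add cyclotomic_poly_dvd_ap_poly) auto
    ultimately show ?thesis
      by simp
  qed
  ultimately have "\<forall>s\<in>{4, 8, 16, 9, 27, 6}. cyclotomic_poly s dvd mask_poly A"
    by blast
  moreover have "finite A" "A \<noteq> {}"
    using card by (auto intro: card_ge_0_finite)
  ultimately show ?thesis
    unfolding MIN_size_def using card by (intro Least_le exI[of _ A]) blast
qed

section \<open>Lower bound: fibers force divisors of the size\<close>

text \<open>Modulo the first polynomial X^(p^i) = 1, so the second becomes p. A common divisor is
  thus constant, and the constant coefficient 1 of the first makes it a unit.\<close>

lemma coprime_fiber_poly_prime_powers:
  assumes "prime p" "0 < i" "i < j"
  shows "coprime (fiber_poly (p ^ i) p) (fiber_poly (p ^ j) p)"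
proof (rule coprimeI)
  fix d assume d: "d dvd fiber_poly (p ^ i) p" "d dvd fiber_poly (p ^ j) p"
  let ?m = "p ^ j div p"
  have p: "p > 0"
    using assms(1) by (rule prime_gt_0_nat)
  have m: "p ^ i dvd ?m"
  proof -
    from \<open>i < j\<close> obtain k where "j = Suc k" "i \<le> k"
      by (cases j) auto
    thus ?thesis
      using p by (simp add: le_imp_power_dvd)
  qed
  have "d dvd monom 1 (p ^ i) - 1"
    using d(1) fiber_poly_mult[of p "p ^ i"] assms by (metis dvd_mult dvd_power)
  hence "d dvd (monom 1 (k * ?m) - 1)" for k
    using monom_minus_1_dvd[of "p ^ i" "k * ?m"] m by (meson dvd_mult dvd_trans)
  hence "d dvd (\<Sum>k<p. monom 1 (k * ?m) - 1)"
    by (intro dvd_sum) auto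
  hence "d dvd fiber_poly (p ^ j) p - of_nat p"
    using assms by (simp add: fiber_poly_eq_sum sum_subtractf)
  hence "d dvd of_nat p"
    using d(2) dvd_diff[of d "fiber_poly (p ^ j) p" "fiber_poly (p ^ j) p - of_nat p"] by simp
  hence "d dvd [:int p:]"
    by (simp add: of_nat_poly)
  moreover have "[:int p:] \<noteq> 0"
    using p by simp
  ultimately have "degree d = 0"
    by (metis degree_pCons_0 dvd_imp_degree_le le_zero_eq)
  then obtain c where c: "d = [:c:]"
    by (rule degree_eq_zeroE)
  have "p ^ i div p > 0"
    using \<open>0 < i\<close> p by (cases i) simp_all
  hence "coeff (fiber_poly (p ^ i) p) 0 = (\<Sum>k<p. if k = 0 then 1 else 0)"
    using assms by (auto simp: fiber_poly_eq_sum coeff_sum intro!: sum.cong)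
  also have "\<dots> = 1"
    using p by simp
  finally have "c dvd 1"
    using d(1) c by (metis const_poly_dvd_iff)
  with c show "is_unit d"
    by (simp add: is_unit_const_poly_iff)
qed

text \<open>The product of pairwise coprime divisors divides \<open>P\<close>, and each factor takes
  the value p at 1.\<close>

lemma prime_power_dvd_poly_1:
  assumes "prime p" "finite I" "0 \<notin> I" "\<forall>i\<in>I. fiber_poly (p ^ i) p dvd P"
  shows "int p ^ card I dvd poly P 1"
proof -
  have "(\<Prod>i\<in>I. fiber_poly (p ^ i) p) dvd P"
    using assms(2,3,4)
  proof (induction I)
    case (insert j I)
    have "coprime (fiber_poly (p ^ i) p) (fiber_poly (p ^ j) p)" if "i \<in> I" for i
      using that insert.hyps insert.prems coprime_fiber_poly_prime_powers[OF assms(1), of i j]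
        coprime_fiber_poly_prime_powers[OF assms(1), of j i]
      by (cases i j rule: linorder_cases) (auto simp: coprime_commute)
    hence "coprime (fiber_poly (p ^ j) p) (\<Prod>i\<in>I. fiber_poly (p ^ i) p)"
      by (intro prod_coprime_right) (auto simp: coprime_commute)
    thus ?case
      using insert by (auto intro: divides_mult)
  qed auto
  moreover have "poly (fiber_poly (p ^ i) p) 1 = int p" for i
    using assms by (simp add: fiber_poly_eq_sum poly_sum poly_monom)
  ultimately show ?thesis
    by (auto elim!: dvdE simp: poly_prod)
qed

text \<open>Supplies the exponent 1 missing from the scales 4, 8, 16 and 9, 27. Both cofactors are
  \<Phi>_6 = X^2 - X + 1.\<close>

lemma fiber_poly_prime_dvd_fiber_poly_6:
  "fiber_poly 2 2 dvd fiber_poly 6 2" "fiber_poly 3 3 dvd fiber_poly 6 3"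
proof -
  have prime: "prime (2 :: nat)" "prime (3 :: nat)"
    by simp_all
  have "(\<Sum>i<2. monom 1 (i * 3)) = ((\<Sum>i<2. monom 1 i) * [:1, -1, 1:] :: int poly)"
    "(\<Sum>i<3. monom 1 (i * 2)) = ((\<Sum>i<3. monom 1 i) * [:1, -1, 1:] :: int poly)"
    by (simp_all add: numeral_2_eq_2 numeral_3_eq_3 monom_Suc monom_0)
  hence "fiber_poly 6 2 = fiber_poly 2 2 * [:1, -1, 1:]" "fiber_poly 6 3 = fiber_poly 3 3 * [:1, -1, 1:]"
    by (simp_all add: fiber_poly_eq_sum[OF prime(1)] fiber_poly_eq_sum[OF prime(2)])
  thus "fiber_poly 2 2 dvd fiber_poly 6 2" "fiber_poly 3 3 dvd fiber_poly 6 3"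
    by (metis dvd_triv_left)+
qed

lemma FIB_size_ge: "FIB_size {4, 8, 16, 9, 27, 6} \<ge> 144"
proof -
  obtain A where A: "finite A" "A \<noteq> {}" "\<forall>s\<in>{4, 8, 16, 9, 27, 6}. fibered_on_scale s A"
    and card: "card A = FIB_size {4, 8, 16, 9, 27, 6}"
    using FIB_size_attained[of "{4, 8, 16, 9, 27, 6}"] by auto
  have primes: "prime (2 :: nat)" "prime (3 :: nat)"
    by simp_all
  have fib: "fiber_poly (p ^ k) p dvd mask_poly A" if "prime p" "fibered_on_scale (p ^ k) A" for p k
  proof -
    obtain q where q: "prime q" "q dvd p ^ k" "fiber_poly (p ^ k) q dvd mask_poly A"
      using \<open>fibered_on_scale (p ^ k) A\<close> by (auto simp: fibered_on_scale_def)
    with \<open>prime p\<close> have "q = p"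
      by (metis prime_dvd_power primes_dvd_imp_eq)
    with q show ?thesis
      by simp
  qed
  have two: "\<forall>i\<in>{2, 3, 4}. fiber_poly (2 ^ i) 2 dvd mask_poly A"
    using fib[OF primes(1), of 2] fib[OF primes(1), of 3] fib[OF primes(1), of 4] A(3) by simp
  have three: "\<forall>i\<in>{2, 3}. fiber_poly (3 ^ i) 3 dvd mask_poly A"
    using fib[OF primes(2), of 2] fib[OF primes(2), of 3] A(3) by simp
  have "poly (mask_poly A) 1 = int (card A)"
    by (simp add: mask_poly_def poly_sum poly_monom)
  hence dvd: "p ^ card I dvd card A"
    if "prime p" "finite I" "0 \<notin> I" "\<forall>i\<in>I. fiber_poly (p ^ i) p dvd mask_poly A" for p I
    using prime_power_dvd_poly_1[OF that] by (metis of_nat_dvd_iff of_nat_power)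
  have "8 dvd card A" "9 dvd card A"
    using dvd[OF primes(1) _ _ two] dvd[OF primes(2) _ _ three] by simp_all
  moreover have "16 dvd card A \<or> 27 dvd card A"
  proof -
    obtain p where p: "prime p" "p dvd 6" "fiber_poly 6 p dvd mask_poly A"
      using A(3) by (auto simp: fibered_on_scale_def)
    have "p dvd 2 * 3"
      using p(2) by simp
    hence "p = 2 \<or> p = 3"
      using p(1) primes by (metis prime_dvd_mult_iff primes_dvd_imp_eq)
    thus ?thesis
    proof
      assume "p = 2"
      hence "\<forall>i\<in>{1, 2, 3, 4}. fiber_poly (2 ^ i) 2 dvd mask_poly A"
        using p(3) two fiber_poly_prime_dvd_fiber_poly_6(1) dvd_trans by auto
      from dvd[OF primes(1) _ _ this] show ?thesis
        by simp
    next
      assume "p = 3"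
      hence "\<forall>i\<in>{1, 2, 3}. fiber_poly (3 ^ i) 3 dvd mask_poly A"
        using p(3) three fiber_poly_prime_dvd_fiber_poly_6(2) dvd_trans by auto
      from dvd[OF primes(2) _ _ this] show ?thesis
        by simp
    qed
  qed
  moreover have "coprime 16 (9 :: nat)" "coprime 8 (27 :: nat)"
    by (code_simp, code_simp)
  ultimately have "144 dvd card A \<or> 216 dvd card A"
    using divides_mult[of 16 "card A" 9] divides_mult[of 8 "card A" 27] by auto
  moreover have "card A > 0"
    using A by (simp add: card_gt_0_iff)
  ultimately show ?thesis
    unfolding card[symmetric] by (auto dest: dvd_imp_le)
qed

theorem theorem1p3:
  shows "\<exists>S :: nat set. finite S \<and> S \<noteq> {} \<and> S \<subseteq> {1..} - {1} \<and>
           MIN_size S < FIB_size S \<and> card (prime_factors (Lcm S)) = 2"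
proof -
  let ?S = "{4, 8, 16, 9, 27, 6} :: nat set"
  have "Lcm ?S = 2 ^ 4 * 3 ^ 3"
    by code_simp
  also have "prime_factors (2 ^ 4 * 3 ^ 3 :: nat) = {2, 3}"
    by (subst prime_factors_product)
      (auto simp: prime_factors_power prime_prime_factors simp del: power_numeral)
  finally have "card (prime_factors (Lcm ?S)) = 2"
    by simp
  moreover have "MIN_size ?S < FIB_size ?S"
    using MIN_size_le FIB_size_ge by simp
  ultimately show ?thesis
    by (intro exI[of _ ?S]) auto
qed

end
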